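(* The diffeomorphisms of $\mathbb T$ that are $n$-th roots of Blaschke products of degree $n$ approximate all orientation-preserving diffeomorphisms of $\mathbb T$ in the $C^1$-norm. That is: for every orientation-preserving diffeomorphism $\Psi:\mathbb T\to\mathbb T$ and every $\varepsilon>0$ there exist an integer $n\ge1$, a Blaschke product of degree $n$ $$B(z)=e^{i\theta}\prod_{j=1}^n\frac{z-a_j}{1-\overline{a_j}\,z},\qquad a_1,\dots,a_n\in\mathbb D,\ \theta\in\mathbb R,$$ and a continuous map $k:\mathbb T\to\mathbb T$ with $k(z)^n=B(z)$ for all $z\in\mathbb T$ (i.e. $k=\sqrt[n]{B}$) such that $\|\Psi-k\|_{C^1}<\varepsilon$.
   Context: $\mathbb D=\{|z|<1\}$ and $\mathbb T=\partial\mathbb D$. Diffeomorphisms of $\mathbb T$ are assumed to be of class $C^\infty$. For a continuously differentiable function $f:\mathbb T\to\mathbb C$, $$\|f\|_{C^1}=\sup_{\theta}\left(|f(e^{i\theta})|+|f'(e^{i\theta})|\right),$$ where $f'(e^{i\theta})$ denotes the derivative of $\theta\mapsto f(e^{i\theta})$ with respect to $\theta$. If $B$ is a Blaschke product of degree $n$, every continuous $k:\mathbb T\to\mathbb T$ with $k^n=B$ on $\mathbb T$ is an orientation-preserving (real-analytic) diffeomorphism of $\mathbb T$. *)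

theory Defs
  imports "HOL-Analysis.Analysis"
begin

text \<open>
  Maps on the circle are represented by total functions on the complex plane, of which only the
  values on the unit circle matter.
\<close>

abbreviation unit_circle :: "complex set" where
  "unit_circle \<equiv> sphere 0 1"

abbreviation on_circle :: "(complex \<Rightarrow> complex) \<Rightarrow> real \<Rightarrow> complex" where
  "on_circle f \<equiv> (\<lambda>\<theta>. f (cis \<theta>))"

text \<open>The derivative is taken with respect to the angle, so it is a function of the angle.\<close>

definition circle_deriv :: "(complex \<Rightarrow> complex) \<Rightarrow> real \<Rightarrow> complex" where
  "circle_deriv f \<theta> = vector_derivative (on_circle f) (at \<theta>)"

definition circle_C1 :: "(complex \<Rightarrow> complex) \<Rightarrow> bool" where
  "circle_C1 f \<longleftrightarrow> on_circle f C1_differentiable_on UNIV"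

text \<open>
  The norm is meaningful under \<open>circle_C1 f\<close>: the supremum is then over a bounded set of reals.
\<close>

definition circle_C1_norm :: "(complex \<Rightarrow> complex) \<Rightarrow> real" where
  "circle_C1_norm f = (SUP \<theta>. norm (f (cis \<theta>)) + norm (circle_deriv f \<theta>))"

text \<open>Class \<open>C\<^sup>\<infinity>\<close>: the angular derivatives of every order exist everywhere.\<close>

definition circle_smooth :: "(complex \<Rightarrow> complex) \<Rightarrow> bool" where
  "circle_smooth f \<longleftrightarrow>
     (\<forall>m. ((\<lambda>g \<theta>. vector_derivative g (at \<theta>)) ^^ m) (on_circle f) differentiable_on UNIV)"

definition circle_diffeo :: "(complex \<Rightarrow> complex) \<Rightarrow> bool" where
  "circle_diffeo f \<longleftrightarrow>
     bij_betw f unit_circle unit_circle \<and> circle_smooth f \<and>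
     circle_smooth (inv_into unit_circle f)"

text \<open>
  The counterclockwise unit tangent vector to the circle at \<open>w\<close> is \<open>\<i> w\<close>. The map preserves
  orientation iff its differential sends the counterclockwise tangent vector at each point to a
  positive multiple of the counterclockwise tangent vector at the image point.
\<close>

definition orientation_preserving :: "(complex \<Rightarrow> complex) \<Rightarrow> bool" where
  "orientation_preserving f \<longleftrightarrow>
     (\<forall>\<theta>. \<exists>c>0. circle_deriv f \<theta> = of_real c * (\<i> * f (cis \<theta>)))"

definition blaschke :: "real \<Rightarrow> nat \<Rightarrow> (nat \<Rightarrow> complex) \<Rightarrow> complex \<Rightarrow> complex" where
  "blaschke \<theta> n a z = cis \<theta> * (\<Prod>j=1..n. (z - a j) / (1 - cnj (a j) * z))"

end

theory Submission
  imports Defs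
begin

text \<open>
  On the circle the factor \<open>(z - a) / (1 - cnj a * z)\<close> moves with an angular speed equal to the
  Poisson kernel of \<open>a\<close>. Hence an \<open>n\<close>-th root of a Blaschke product of degree \<open>n\<close> is \<open>cis x \<mapsto> cis (h x)\<close>
  where \<open>h'\<close> is the mean of the \<open>n\<close> Poisson kernels of the zeros, and every such mean occurs. An
  orientation-preserving diffeomorphism is \<open>cis x \<mapsto> cis (g x)\<close> with \<open>g' = u > 0\<close> continuous and
  \<open>g (x + 2*pi) = g x + 2*pi\<close>. So it is enough to approximate \<open>u\<close> uniformly by means of Poisson kernels:
  the free constant of \<open>h\<close> makes \<open>h 0 = g 0\<close>, integration over one period makes \<open>h\<close> close to \<open>g\<close>, and
  both together bound the \<open>C\<^sup>1\<close> distance.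

  For the approximation, choose angles \<open>t\<^sub>j\<close> that cut the image circle into \<open>n\<close> equal arcs, that is
  \<open>g (t\<^sub>j) = g 0 + 2*pi*j/n\<close>, and put the zeros at \<open>r * cis (t\<^sub>j)\<close>. With \<open>P\<^sub>r\<close> the Poisson kernel, the mean
  of the \<open>P\<^sub>r (x - t\<^sub>j)\<close> is then a Riemann-Stieltjes sum for the Poisson integral of \<open>u\<close>, which tends to
  \<open>u\<close> as \<open>r \<rightarrow> 1\<close>. The estimate \<open>poisson_riemann_sum\<close> makes this quantitative without forming the
  integral. On each arc it compares the term of the sum with the increment of an antiderivative of
  the kernel, which is the argument of a single Blaschke factor and grows by \<open>2*pi\<close> over a period.
  Uniformity in \<open>x\<close> comes from a Korovkin-type argument: \<open>\<bar>u s - u x\<bar> \<le> \<eta> + K * (1 - cos (s - x))\<close>, and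
  \<open>P\<^sub>r s * (1 - cos s) \<le> (1 - r\<^sup>2) / (2*r)\<close> is small for \<open>r\<close> near 1.
\<close>

section \<open>Angles and periodic functions\<close>

lemma norm_cis_diff_le: "norm (cis a - cis b) \<le> \<bar>a - b\<bar>"
proof -
  have "norm (cis a - cis b) \<le> 1 * norm (a - b)"
  proof (rule differentiable_bound[of UNIV cis "\<lambda>x h. h *\<^sub>R (\<i> * cis x)"])
    show "(cis has_derivative (\<lambda>h. h *\<^sub>R (\<i> * cis x))) (at x within UNIV)" for x
      using has_derivative_cis[of "\<lambda>x. x" "\<lambda>x. x" x UNIV] by simp
    show "onorm (\<lambda>h. h *\<^sub>R (\<i> * cis x)) \<le> 1" for x
      by (rule onorm_le) (simp add: norm_mult)
  qed auto
  then show ?thesis by simp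
qed

lemma cis_sum: "cis (\<Sum>j\<in>A. f j) = (\<Prod>j\<in>A. cis (f j))"
  by (induction A rule: infinite_finite_induct) (auto simp flip: cis_mult)

lemma has_vector_derivative_cis_compose:
  assumes "(g has_real_derivative g') (at x)"
  shows "((\<lambda>x. cis (g x)) has_vector_derivative of_real g' * (\<i> * cis (g x))) (at x)"
proof -
  have "(g has_derivative (\<lambda>t. t * g')) (at x)"
    using assms by (simp add: has_field_derivative_def mult_commute_abs)
  from has_derivative_cis[OF this] show ?thesis
    by (simp add: has_vector_derivative_def scaleR_conv_of_real mult_ac)
qed

lemma angle_representative:
  obtains k :: int where "c \<le> x + of_int k * (2*pi)" "x + of_int k * (2*pi) < c + 2*pi"
proof -
  define k where "k = \<lfloor>(x - c) / (2*pi)\<rfloor>"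
  have "of_int k \<le> (x - c) / (2*pi)" "(x - c) / (2*pi) < of_int k + 1"
    unfolding k_def by linarith+
  then have "of_int k * (2*pi) \<le> x - c" "x - c < (of_int k + 1) * (2*pi)"
    by (simp_all add: pos_le_divide_eq pos_divide_less_eq)
  then show ?thesis using that[of "-k"] by (simp add: algebra_simps)
qed

lemma derivative_of_degree_one_lift_periodic:
  fixes g u :: "real \<Rightarrow> real"
  assumes g: "\<And>s. (g has_real_derivative u s) (at s)"
    and shift: "\<And>s. g (s + 2*pi) = g s + 2*pi"
  shows "u (s + 2*pi) = u s"
proof (rule DERIV_unique)
  show "((\<lambda>s. g (s + 2*pi)) has_real_derivative u (s + 2*pi)) (at s)"
    using g[of "s + 2*pi"] by (simp only: DERIV_shift)
  show "((\<lambda>s. g (s + 2*pi)) has_real_derivative u s) (at s)"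
    unfolding shift by (auto intro!: derivative_eq_intros g)
qed

lemma periodic_value_in_fundamental_interval:
  assumes per: "\<And>x::real. u (x + 2*pi) = u x"
  shows "\<exists>y\<in>{0..2*pi}. u x = u y"
proof -
  interpret periodic_fun_simple u "2*pi" by standard (rule per)
  obtain k :: int where "0 \<le> x + of_int k * (2*pi)" "x + of_int k * (2*pi) < 0 + 2*pi"
    by (rule angle_representative)
  then show ?thesis by (intro bexI[of _ "x + of_int k * (2*pi)"]) (auto simp: plus_of_int)
qed

lemma periodic_positive_bounds:
  fixes u :: "real \<Rightarrow> real"
  assumes cont: "continuous_on UNIV u" and per: "\<And>x. u (x + 2*pi) = u x" and pos: "\<And>x. 0 < u x"
  obtains m M where "0 < m" "\<And>x. m \<le> u x" "0 < M" "\<And>x. u x \<le> M"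
proof -
  have cont': "continuous_on {0..2*pi} u" by (rule continuous_on_subset[OF cont]) auto
  obtain s0 where s0: "\<forall>s\<in>{0..2*pi}. u s0 \<le> u s"
    using continuous_attains_inf[OF compact_Icc _ cont'] by fastforce
  obtain s1 where s1: "\<forall>s\<in>{0..2*pi}. u s \<le> u s1"
    using continuous_attains_sup[OF compact_Icc _ cont'] by fastforce
  note rep = periodic_value_in_fundamental_interval[of u, OF per]
  show ?thesis
    by (rule that[of "u s0" "u s1"]) (use pos rep s0 s1 in \<open>(metis)+\<close>)
qed

section \<open>The Poisson kernel\<close>

definition poisson :: "real \<Rightarrow> real \<Rightarrow> real" where
  "poisson r s = (1 - r\<^sup>2) / (1 - 2 * r * cos s + r\<^sup>2)"

text \<open>
  This form of \<open>\<bar>1 - r * cis s\<bar>\<^sup>2\<close> shows both lower bounds on which the kernel estimates rest: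
  \<open>(1 - r)\<^sup>2\<close>, which is uniform in \<open>s\<close>, and \<open>2 * r * (1 - cos s)\<close>, which holds uniformly as \<open>r \<rightarrow> 1\<close>.
\<close>

lemma poisson_denominator_eq: "1 - 2 * (r::real) * cos s + r\<^sup>2 = (1 - r)\<^sup>2 + 2 * r * (1 - cos s)"
  by (simp add: power2_eq_square algebra_simps)

lemma poisson_denominator_ge:
  fixes r :: real assumes "0 < r" shows "(1 - r)\<^sup>2 \<le> 1 - 2 * r * cos s + r\<^sup>2"
  unfolding poisson_denominator_eq using assms by simp

lemma poisson_denominator_pos:
  fixes r :: real assumes "0 < r" "r < 1" shows "0 < 1 - 2 * r * cos s + r\<^sup>2"
  using poisson_denominator_ge[OF assms(1), of s] assms by (smt (verit) zero_less_power)

lemma poisson_pos: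
  assumes "0 < r" "r < 1" shows "0 < poisson r s"
  unfolding poisson_def using poisson_denominator_pos[OF assms] assms
  by (simp add: power_less_one_iff abs_square_less_1)

lemma poisson_minus_commute: "poisson r (x - y) = poisson r (y - x)"
  using cos_minus[of "x - y"] by (simp add: poisson_def)

text \<open>
  Concentration of the kernel at \<open>0\<close>: the weight \<open>1 - cos s\<close> cancels the peak, and the bound tends to
  \<open>0\<close> as \<open>r \<rightarrow> 1\<close>.
\<close>

lemma poisson_one_minus_cos_le:
  assumes "0 < r" "r < 1" shows "poisson r s * (1 - cos s) \<le> (1 - r\<^sup>2) / (2 * r)"
proof -
  have "2 * r * (1 - cos s) \<le> 1 - 2 * r * cos s + r\<^sup>2"
    unfolding poisson_denominator_eq by simp
  moreover have "0 \<le> 1 - r\<^sup>2" using assms by (simp add: power_le_one)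
  ultimately have "(1 - r\<^sup>2) * (2 * r * (1 - cos s)) \<le> (1 - r\<^sup>2) * (1 - 2 * r * cos s + r\<^sup>2)"
    by (rule mult_left_mono)
  then show ?thesis unfolding poisson_def using poisson_denominator_pos[OF assms, of s] assms
    by (simp add: field_simps)
qed

lemma poisson_lipschitz:
  assumes "0 < r" "r < 1" shows "\<bar>poisson r a - poisson r b\<bar> \<le> 2 / (1 - r)^4 * \<bar>a - b\<bar>"
proof -
  let ?D = "\<lambda>s. 1 - 2 * r * cos s + r\<^sup>2"
  have D: "?D a > 0" "?D b > 0" using poisson_denominator_pos assms by auto
  have "poisson r a - poisson r b = (1 - r\<^sup>2) * (2 * r * (cos a - cos b)) / (?D a * ?D b)"
    unfolding poisson_def using D by (simp add: diff_frac_eq algebra_simps)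
  then have "\<bar>poisson r a - poisson r b\<bar> = (1 - r\<^sup>2) * r * (2 * \<bar>cos a - cos b\<bar>) / (?D a * ?D b)"
    using D assms by (simp add: abs_mult power_le_one)
  also have "\<dots> \<le> 2 * \<bar>a - b\<bar> / ((1 - r)\<^sup>2 * (1 - r)\<^sup>2)"
  proof (rule frac_le)
    have "\<bar>cos a - cos b\<bar> \<le> \<bar>a - b\<bar>"
      using abs_Re_le_cmod[of "cis a - cis b"] norm_cis_diff_le[of a b] by simp
    moreover have "(1 - r\<^sup>2) * r \<le> 1" "0 \<le> (1 - r\<^sup>2) * r"
      using assms by (auto intro!: mult_le_one simp: power_le_one)
    ultimately show "(1 - r\<^sup>2) * r * (2 * \<bar>cos a - cos b\<bar>) \<le> 2 * \<bar>a - b\<bar>"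
      by (smt (verit) mult_left_le_one_le)
    show "(1 - r)\<^sup>2 * (1 - r)\<^sup>2 \<le> ?D a * ?D b"
      using poisson_denominator_ge[OF assms(1)] D by (intro mult_mono) auto
  qed (use assms in auto)
  also have "\<dots> = 2 / (1 - r)^4 * \<bar>a - b\<bar>" by (simp flip: power_add)
  finally show ?thesis .
qed

lemma continuous_on_poisson:
  assumes "0 < r" "r < 1" shows "continuous_on S (\<lambda>x. poisson r (x - t))"
  unfolding poisson_def using poisson_denominator_pos[OF assms]
  by (intro continuous_intros) (metis less_irrefl)

section \<open>The argument of a Blaschke factor\<close>

text \<open>
  A continuous argument of \<open>(z - a) / (1 - cnj a * z)\<close> at \<open>z = cis x\<close>. There \<open>z - a = z * cnj (1 - cnj a * z)\<close>,
  and \<open>1 - cnj a * z\<close> stays in the right half plane, so the principal logarithm has no jump.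
\<close>

definition blaschke_arg :: "complex \<Rightarrow> real \<Rightarrow> real" where
  "blaschke_arg a x = x - 2 * Im (Ln (1 - cnj a * cis x))"

lemma Re_blaschke_denominator_pos:
  assumes "norm a < 1" "norm z = 1"
  shows "Re (1 - cnj a * z) > 0"
proof -
  have "Re (cnj a * z) \<le> norm (cnj a * z)" by (rule complex_Re_le_cmod)
  also have "\<dots> < 1" using assms by (simp add: norm_mult)
  finally show ?thesis by simp
qed

lemma cis_Im_Ln:
  assumes "w \<noteq> 0" shows "cis (- 2 * Im (Ln w)) = cnj w / w"
proof -
  have "w = of_real (norm w) * cis (Im (Ln w))"
    using assms exp_Ln[of w] by (metis exp_eq_polar norm_exp_eq_Re of_real_exp)
  moreover have "cnj (of_real (norm w) * cis (Im (Ln w))) / (of_real (norm w) * cis (Im (Ln w))) = cis (- 2 * Im (Ln w))"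
    using assms by (simp add: cis_cnj cis_divide)
  ultimately show ?thesis by simp
qed

lemma blaschke_factor_polar:
  assumes "norm a < 1" "norm z = 1"
  shows "z * cis (- 2 * Im (Ln (1 - cnj a * z))) = (z - a) / (1 - cnj a * z)"
proof -
  have nz: "1 - cnj a * z \<noteq> 0" using Re_blaschke_denominator_pos[OF assms] by (metis less_irrefl zero_complex.sel(1))
  have "z * cnj z = 1" using assms(2) by (simp add: flip: complex_norm_square)
  then have "z * cnj (1 - cnj a * z) = z - a" by (simp add: algebra_simps)
  then show ?thesis unfolding cis_Im_Ln[OF nz] by simp
qed

text \<open>
  With \<open>q = cnj a * cis x\<close> the derivative is \<open>Re ((1 + q) / (1 - q)) = (1 - \<bar>q\<bar>\<^sup>2) / \<bar>1 - q\<bar>\<^sup>2\<close>.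
\<close>

lemma blaschke_arg_deriv:
  assumes "0 < r" "r < 1"
  shows "(blaschke_arg (of_real r * cis t) has_real_derivative poisson r (x - t)) (at x)"
proof -
  define a where "a = of_real r * cis t"
  have na: "norm a < 1" using assms by (simp add: a_def norm_mult)
  define q where "q = cnj a * cis x"
  have q: "q = of_real r * cis (x - t)" by (simp add: q_def a_def cis_cnj cis_mult)
  have pos: "Re (1 - q) > 0" unfolding q_def by (rule Re_blaschke_denominator_pos[OF na]) simp
  have "((\<lambda>x. 1 - cnj a * cis x) has_vector_derivative - (\<i> * q)) (at x)"
    unfolding q_def
    using has_vector_derivative_diff[OF has_vector_derivative_const[of 1]
        has_vector_derivative_mult_right[OF has_vector_derivative_cis_compose[OF DERIV_ident], of "cnj a" x]]
    by (simp add: mult.left_commute)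
  moreover have "(Ln has_field_derivative inverse (1 - q)) (at (1 - cnj a * cis x))"
    using pos by (auto simp: q_def complex_nonpos_Reals_iff intro!: has_field_derivative_Ln)
  ultimately have "((\<lambda>x. Ln (1 - cnj a * cis x)) has_vector_derivative (- (\<i> * q) * inverse (1 - q))) (at x)"
    by (rule field_vector_diff_chain_at[unfolded o_def])
  then have "((\<lambda>x. Im (Ln (1 - cnj a * cis x))) has_vector_derivative Im (- (\<i> * q) * inverse (1 - q))) (at x)"
    using bounded_linear.has_vector_derivative[OF bounded_linear_Im] by blast
  then have "((\<lambda>x. Im (Ln (1 - cnj a * cis x))) has_real_derivative Im (- (\<i> * q) * inverse (1 - q))) (at x)"
    by (simp add: has_real_derivative_iff_has_vector_derivative)
  from DERIV_diff[OF DERIV_ident DERIV_cmult[OF this, of 2]]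
  have "(blaschke_arg a has_real_derivative 1 - 2 * Im (- (\<i> * q) * inverse (1 - q))) (at x)"
    unfolding blaschke_arg_def[abs_def] .
  moreover have "1 - 2 * Im (- (\<i> * q) * inverse (1 - q)) = poisson r (x - t)"
  proof -
    have nz: "1 - q \<noteq> 0" using pos by auto
    have D: "(cmod (1 - q))\<^sup>2 = 1 - 2 * r * cos (x - t) + r\<^sup>2"
      unfolding cmod_power2 q using sin_cos_squared_add[of "x - t"]
      by (simp add: power2_eq_square) algebra
    have "1 - 2 * Im (- (\<i> * q) * inverse (1 - q)) = Re ((1 + q) / (1 - q))"
    proof -
      have "(1 + q) / (1 - q) = 1 + 2 * (q / (1 - q))" using nz by (simp add: field_simps)
      then show ?thesis by (simp add: divide_inverse)
    qed
    also have "\<dots> = Re ((1 + q) * cnj (1 - q)) / (cmod (1 - q))\<^sup>2"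
      by (simp add: complex_div_cnj[of "1 + q"] flip: of_real_power)
    also have "Re ((1 + q) * cnj (1 - q)) = 1 - r\<^sup>2"
      unfolding q using sin_cos_squared_add[of "x - t"]
      by (simp add: power2_eq_square) algebra
    finally show ?thesis by (simp add: poisson_def D)
  qed
  ultimately show ?thesis by (simp add: a_def)
qed

text \<open>
  With \<open>blaschke_arg_deriv\<close> this says that the Poisson kernel has mean 1 over a period.
\<close>

lemma blaschke_arg_plus_2pi: "blaschke_arg a (x + 2*pi) = blaschke_arg a x + 2*pi"
  by (simp add: blaschke_arg_def flip: cis_mult)

section \<open>Uniform approximation by means of Poisson kernels\<close>

text \<open>
  Nearby points (modulo the period) contribute at most \<open>\<eta>\<close>, by uniform continuity; for points at
  distance at least \<open>d\<close>, the weight \<open>1 - cos\<close> is bounded below, so a large \<open>K\<close> absorbs the oscillation.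
  The weight \<open>1 - cos\<close> is the one that \<open>poisson_one_minus_cos_le\<close> controls.
\<close>

lemma periodic_modulus_of_continuity:
  fixes u :: "real \<Rightarrow> real"
  assumes cont: "continuous_on UNIV u" and per: "\<And>x. u (x + 2*pi) = u x" and "\<eta> > 0"
  obtains K where "K \<ge> 0" "\<And>x y. \<bar>u x - u y\<bar> \<le> \<eta> + K * (1 - cos (x - y))"
proof -
  interpret periodic_fun_simple u "2*pi" by standard (rule per)
  have "uniformly_continuous_on {-pi..3*pi} u"
    by (intro compact_uniformly_continuous continuous_on_subset[OF cont]) auto
  then obtain d0 where d0: "d0 > 0"
    "\<And>x y. x \<in> {-pi..3*pi} \<Longrightarrow> y \<in> {-pi..3*pi} \<Longrightarrow> dist y x < d0 \<Longrightarrow> dist (u y) (u x) < \<eta>"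
    unfolding uniformly_continuous_on_def using \<open>\<eta> > 0\<close> by metis
  define d where "d = min d0 pi"
  have d: "0 < d" "d \<le> pi" "d \<le> d0" using d0(1) by (auto simp: d_def)
  have "compact (u ` {-pi..3*pi})"
    by (intro compact_continuous_image continuous_on_subset[OF cont]) auto
  then obtain M where "\<forall>y\<in>u ` {-pi..3*pi}. \<bar>y\<bar> \<le> M"
    by (auto dest!: compact_imp_bounded simp: bounded_iff)
  then have M: "\<And>x. x \<in> {-pi..3*pi} \<Longrightarrow> \<bar>u x\<bar> \<le> M" by blast
  have M0: "0 \<le> M" using M[of 0] by simp
  have cosd: "cos d < 1" using cos_monotone_0_pi[of 0 d] d by simp
  define K where "K = 2 * M / (1 - cos d)"
  show ?thesis
  proof (rule that[of K])
    show K0: "0 \<le> K" using M0 cosd by (simp add: K_def)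
    fix x y
    obtain k :: int where k: "0 \<le> y + of_int k * (2*pi)" "y + of_int k * (2*pi) < 0 + 2*pi"
      by (rule angle_representative)
    define y' where "y' = y + of_int k * (2*pi)"
    obtain l :: int where l: "y' - pi \<le> x + of_int l * (2*pi)" "x + of_int l * (2*pi) < y' - pi + 2*pi"
      by (rule angle_representative)
    define x' where "x' = x + of_int l * (2*pi)"
    have eq: "u x = u x'" "u y = u y'" by (simp_all add: x'_def y'_def plus_of_int)
    have "x' - y' = (x - y) + of_int (l - k) * (2*pi)" by (simp add: x'_def y'_def algebra_simps)
    then have cs: "cos (x - y) = cos \<bar>x' - y'\<bar>"
      using cos.plus_of_int[of "x - y" "l - k"] by simp
    \<comment> \<open>The interval \<open>{-pi..3*pi}\<close> contains a representative of \<open>y\<close> in \<open>[0, 2*pi)\<close> together with the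
      representative of \<open>x\<close> that is nearest to it.\<close>
    have in_dom: "x' \<in> {-pi..3*pi}" "y' \<in> {-pi..3*pi}" and close: "\<bar>x' - y'\<bar> \<le> pi"
      using k l by (auto simp: x'_def[symmetric] y'_def[symmetric])
    show "\<bar>u x - u y\<bar> \<le> \<eta> + K * (1 - cos (x - y))"
    proof (cases "\<bar>x' - y'\<bar> < d")
      case True
      then have "\<bar>u x - u y\<bar> \<le> \<eta>"
        using d0(2)[OF in_dom(2) in_dom(1)] d(3) by (simp add: dist_real_def eq)
      moreover have "0 \<le> K * (1 - cos (x - y))" using K0 by simp
      ultimately show ?thesis by linarith
    next
      case False
      then have "cos (x - y) \<le> cos d"
        unfolding cs using d close by (intro cos_monotone_0_pi_le) auto
      then have "K * (1 - cos d) \<le> K * (1 - cos (x - y))" using K0 by (intro mult_left_mono) auto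
      moreover have "K * (1 - cos d) = 2 * M" using cosd by (simp add: K_def)
      moreover have "\<bar>u x - u y\<bar> \<le> 2 * M" unfolding eq using M[OF in_dom(1)] M[OF in_dom(2)] by linarith
      ultimately show ?thesis using \<open>\<eta> > 0\<close> by linarith
    qed
  qed
qed

lemma increment_bound_by_derivative:
  fixes H \<phi> :: "real \<Rightarrow> real"
  assumes "a \<le> b"
    and H: "\<And>s. s \<in> {a..b} \<Longrightarrow> (H has_real_derivative H' s) (at s)"
    and \<phi>: "\<And>s. s \<in> {a..b} \<Longrightarrow> (\<phi> has_real_derivative \<phi>' s) (at s)"
    and le: "\<And>s. s \<in> {a..b} \<Longrightarrow> \<bar>H' s\<bar> \<le> \<phi>' s"
  shows "\<bar>H b - H a\<bar> \<le> \<phi> b - \<phi> a"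
proof -
  have "\<phi> a - H a \<le> \<phi> b - H b"
  proof (rule DERIV_nonneg_imp_nondecreasing[OF \<open>a \<le> b\<close>])
    fix s assume "a \<le> s" "s \<le> b"
    then show "\<exists>y. ((\<lambda>s. \<phi> s - H s) has_real_derivative y) (at s) \<and> 0 \<le> y"
      using DERIV_diff[OF \<phi> H, of s] le[of s] by (intro exI[of _ "\<phi>' s - H' s"]) auto
  qed
  moreover have "\<phi> a + H a \<le> \<phi> b + H b"
  proof (rule DERIV_nonneg_imp_nondecreasing[OF \<open>a \<le> b\<close>])
    fix s assume "a \<le> s" "s \<le> b"
    then show "\<exists>y. ((\<lambda>s. \<phi> s + H s) has_real_derivative y) (at s) \<and> 0 \<le> y"
      using DERIV_add[OF \<phi> H, of s] le[of s] by (intro exI[of _ "\<phi>' s + H' s"]) auto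
  qed
  ultimately show ?thesis by linarith
qed

text \<open>
  Over a partition of a full period, the sum is a Riemann-Stieltjes sum for the integral of
  \<open>poisson r (x - s) * u s\<close> and \<open>2*pi * u x\<close> is the integral of \<open>poisson r (x - s) * u x\<close>. On
  each piece the term of the sum is the increment of \<open>poisson r (x - t (Suc j)) * g\<close>, and the integral
  is that of \<open>u x * F\<close> with \<open>F\<close> an antiderivative of the kernel, so a comparison of derivatives on each piece gives the estimate, and
  the errors telescope. In the bound, \<open>\<eta>\<close> and \<open>K\<close> account for replacing \<open>u s\<close> by \<open>u x\<close>, and \<open>\<omega>\<close> for
  freezing the kernel at the right end point.
\<close>

lemma poisson_riemann_sum:
  fixes g u :: "real \<Rightarrow> real" and t :: "nat \<Rightarrow> real"
  assumes r: "0 < r" "r < 1"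
    and g: "\<And>s. (g has_real_derivative u s) (at s)"
    and u: "\<And>s. 0 \<le> u s" "\<And>s. u s \<le> M"
    and K: "0 \<le> K" and modulus: "\<And>x y. \<bar>u x - u y\<bar> \<le> \<eta> + K * (1 - cos (x - y))"
    and t: "\<And>j. j < n \<Longrightarrow> t j \<le> t (Suc j)" "\<And>j. j < n \<Longrightarrow> t (Suc j) - t j \<le> \<omega>"
    and period: "t n = t 0 + 2*pi"
  shows "\<bar>(\<Sum>j<n. poisson r (x - t (Suc j)) * (g (t (Suc j)) - g (t j))) - 2*pi * u x\<bar>
         \<le> 2*pi * (\<eta> + (K * ((1 - r\<^sup>2) / (2*r)) + 2 / (1 - r)^4 * \<omega> * M))"
proof -
  define F where "F = blaschke_arg (of_real r * cis x)"
  define C where "C = K * ((1 - r\<^sup>2) / (2*r)) + 2 / (1 - r)^4 * \<omega> * M"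
  have F: "(F has_real_derivative poisson r (s - x)) (at s)" for s
    unfolding F_def using blaschke_arg_deriv[OF r] .
  have F_total: "F (t n) - F (t 0) = 2*pi"
    by (simp add: period F_def blaschke_arg_plus_2pi)
  have step: "\<bar>poisson r (x - t (Suc j)) * (g (t (Suc j)) - g (t j)) - u x * (F (t (Suc j)) - F (t j))\<bar>
        \<le> \<eta> * (F (t (Suc j)) - F (t j)) + C * (t (Suc j) - t j)" if j: "j < n" for j
  proof -
    let ?p = "poisson r (x - t (Suc j))"
    let ?H = "\<lambda>s. ?p * g s - u x * F s" and ?\<phi> = "\<lambda>s. \<eta> * F s + C * s"
    have "\<bar>?H (t (Suc j)) - ?H (t j)\<bar> \<le> ?\<phi> (t (Suc j)) - ?\<phi> (t j)"
    proof (rule increment_bound_by_derivative[OF t(1)[OF j]])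
      fix s assume s: "s \<in> {t j..t (Suc j)}"
      show "(?H has_real_derivative ?p * u s - u x * poisson r (s - x)) (at s)"
        by (auto intro!: derivative_eq_intros g F)
      show "(?\<phi> has_real_derivative \<eta> * poisson r (s - x) + C) (at s)"
        by (auto intro!: derivative_eq_intros F)
      have "\<bar>?p - poisson r (s - x)\<bar> \<le> 2 / (1 - r)^4 * \<bar>(x - t (Suc j)) - (x - s)\<bar>"
        unfolding poisson_minus_commute[of r s x] by (rule poisson_lipschitz[OF r])
      also have "\<dots> \<le> 2 / (1 - r)^4 * \<omega>"
        using s t(2)[OF j] r by (intro mult_left_mono) auto
      finally have 1: "\<bar>?p - poisson r (s - x)\<bar> * u s \<le> 2 / (1 - r)^4 * \<omega> * M"
        using u[of s] by (intro mult_mono) auto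
      have "poisson r (s - x) * \<bar>u s - u x\<bar> \<le> poisson r (s - x) * (\<eta> + K * (1 - cos (s - x)))"
        using modulus[of s x] poisson_pos[OF r, of "s - x"] by (intro mult_left_mono) auto
      also have "\<dots> = \<eta> * poisson r (s - x) + K * (poisson r (s - x) * (1 - cos (s - x)))"
        by (simp add: algebra_simps)
      also have "\<dots> \<le> \<eta> * poisson r (s - x) + K * ((1 - r\<^sup>2) / (2*r))"
        using poisson_one_minus_cos_le[OF r] K by (intro add_left_mono mult_left_mono) auto
      finally have 2: "poisson r (s - x) * \<bar>u s - u x\<bar> \<le> \<eta> * poisson r (s - x) + K * ((1 - r\<^sup>2) / (2*r))" .
      have "?p * u s - u x * poisson r (s - x) = (?p - poisson r (s - x)) * u s + poisson r (s - x) * (u s - u x)"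
        by (simp add: algebra_simps)
      then have "\<bar>?p * u s - u x * poisson r (s - x)\<bar> \<le> \<bar>?p - poisson r (s - x)\<bar> * u s + poisson r (s - x) * \<bar>u s - u x\<bar>"
        using abs_triangle_ineq[of "(?p - poisson r (s - x)) * u s" "poisson r (s - x) * (u s - u x)"]
          u(1)[of s] poisson_pos[OF r, of "s - x"] by (simp add: abs_mult)
      then show "\<bar>?p * u s - u x * poisson r (s - x)\<bar> \<le> \<eta> * poisson r (s - x) + C"
        using 1 2 unfolding C_def by linarith
    qed
    then show ?thesis by (simp add: algebra_simps)
  qed
  have tele: "(\<Sum>j<n. F (t (Suc j)) - F (t j)) = 2*pi" "(\<Sum>j<n. t (Suc j) - t j) = 2*pi"
    using sum_lessThan_telescope[of "\<lambda>j. F (t j)" n] sum_lessThan_telescope[of t n] F_total period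
    by simp_all
  have "(\<Sum>j<n. poisson r (x - t (Suc j)) * (g (t (Suc j)) - g (t j))) - 2*pi * u x
      = (\<Sum>j<n. poisson r (x - t (Suc j)) * (g (t (Suc j)) - g (t j)) - u x * (F (t (Suc j)) - F (t j)))"
    unfolding sum_subtractf[of _ "\<lambda>j. u x * _ j"] sum_distrib_left[symmetric] tele by simp
  also have "\<bar>\<dots>\<bar> \<le> (\<Sum>j<n. \<eta> * (F (t (Suc j)) - F (t j)) + C * (t (Suc j) - t j))"
    using step by (intro order_trans[OF sum_abs] sum_mono) auto
  also have "\<dots> = 2*pi * (\<eta> + C)"
    unfolding sum.distrib sum_distrib_left[symmetric] tele by (simp add: algebra_simps)
  finally show ?thesis unfolding C_def .
qed

text \<open>
  Since \<open>g (t (Suc j)) - g (t j) = 2*pi/n\<close> for all \<open>j\<close>, the weights in \<open>poisson_riemann_sum\<close> are equal and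
  the sum is \<open>2*pi\<close> times a mean. The order of the choices matters: \<open>K\<close> depends on \<open>\<delta>\<close>, then \<open>r\<close> is
  chosen close to 1 depending on \<open>K\<close>, and \<open>n\<close> last, because the Lipschitz constant of the kernel
  blows up as \<open>r \<rightarrow> 1\<close>.
\<close>

lemma poisson_means_dense:
  fixes g u :: "real \<Rightarrow> real"
  assumes g: "\<And>s. (g has_real_derivative u s) (at s)"
    and cont: "continuous_on UNIV u" and pos: "\<And>s. 0 < u s"
    and shift: "\<And>s. g (s + 2*pi) = g s + 2*pi"
    and "\<delta> > 0"
  obtains r :: real and n :: nat and t :: "nat \<Rightarrow> real" where "0 < r" "r < 1" "n \<ge> 1"
    "\<And>x. \<bar>(\<Sum>j=1..n. poisson r (x - t j)) / n - u x\<bar> \<le> \<delta>"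
proof -
  have per: "u (x + 2*pi) = u x" for x
    by (rule derivative_of_degree_one_lift_periodic[of g, OF g shift])
  obtain m M where m: "0 < m" "\<And>s. m \<le> u s" and M: "0 < M" "\<And>s. u s \<le> M"
    using periodic_positive_bounds[OF cont per pos] by blast
  obtain K where K: "K \<ge> 0" "\<And>x y. \<bar>u x - u y\<bar> \<le> \<delta>/3 + K * (1 - cos (x - y))"
    using periodic_modulus_of_continuity[OF cont per, of "\<delta>/3"] \<open>\<delta> > 0\<close> by (metis divide_pos_pos zero_less_numeral)
  define e where "e = \<delta> / 3 / (K + 1)"
  have "e > 0" using \<open>\<delta> > 0\<close> K(1) by (simp add: e_def)
  define r where "r = 1 - min (1/2) (e / 2)"
  have r: "0 < r" "r < 1" "1/2 \<le> r" "1 - r \<le> e / 2"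
    using \<open>e > 0\<close> by (auto simp: r_def min_def)
  have kernel_error: "K * ((1 - r\<^sup>2) / (2*r)) \<le> \<delta>/3"
  proof -
    have "(1 - r\<^sup>2) / (2*r) = (1 - r) * ((1 + r) / (2*r))" by (simp add: power2_eq_square algebra_simps)
    also have "\<dots> \<le> (1 - r) * 2" using r by (intro mult_left_mono) (auto simp: divide_simps)
    also have "\<dots> \<le> e / 2 * 2" using r(4) by (intro mult_right_mono) auto
    also have "\<dots> = e" by simp
    finally have "K * ((1 - r\<^sup>2) / (2*r)) \<le> (K + 1) * e"
      using K(1) r by (intro mult_mono) (auto simp: power_le_one)
    also have "\<dots> = \<delta> / 3" using nonzero_eq_divide_eq[of "K + 1" e "\<delta> / 3"] K(1) by (simp add: e_def mult.commute)
    finally show ?thesis .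
  qed
  \<comment> \<open>As \<open>u \<ge> m\<close>, consecutive angles differ by at most \<open>2*pi / (m * n)\<close>.\<close>
  define c where "c = 2 / (1 - r)^4 * (2*pi / m) * M"
  have c: "0 < c" using r m M by (simp add: c_def)
  obtain n :: nat where n: "3 * c / \<delta> < n" using reals_Archimedean2 by blast
  have n0: "0 < n" using n c \<open>\<delta> > 0\<close> by (metis divide_pos_pos mult_pos_pos of_nat_0_less_iff order_less_trans zero_less_numeral)
  have step_error: "2 / (1 - r)^4 * (2*pi / (m * n)) * M \<le> \<delta>/3"
  proof -
    have "2 / (1 - r)^4 * (2*pi / (m * n)) * M = c / n" by (simp add: c_def)
    also have "\<dots> \<le> \<delta>/3" using n n0 \<open>\<delta> > 0\<close> by (simp add: field_simps)
    finally show ?thesis .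
  qed
  have growth: "m * (b - a) \<le> g b - g a" if "a \<le> b" for a b
  proof -
    have "g a - m * a \<le> g b - m * b"
    proof (rule DERIV_nonneg_imp_nondecreasing[OF that])
      show "\<exists>y. ((\<lambda>s. g s - m * s) has_real_derivative y) (at s) \<and> 0 \<le> y" for s
        using m(2)[of s] by (intro exI[of _ "u s - m"]) (auto intro!: derivative_eq_intros g)
    qed
    then show ?thesis by (simp add: algebra_simps)
  qed
  have mono: "a \<le> b" if "g a \<le> g b" for a b
  proof (rule ccontr)
    assume "\<not> a \<le> b"
    then have "0 < m * (a - b)" using m(1) by simp
    then show False using growth[of b a] that \<open>\<not> a \<le> b\<close> by simp
  qed
  have gc: "continuous_on S g" for S by (meson g DERIV_continuous_on has_field_derivative_at_within)
  have "\<exists>s. g s = g 0 + 2*pi * j / n" if "j \<le> n" for j :: nat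
  proof -
    have "real j / n \<le> 1" using that n0 by (simp add: divide_le_eq)
    then have "2*pi * (j / n) \<le> 2*pi" by (intro mult_left_le) auto
    then have "\<exists>s\<ge>0. s \<le> 2*pi \<and> g s = g 0 + 2*pi * j / n"
      using shift[of 0] by (intro IVT' gc) auto
    then show ?thesis by blast
  qed
  then obtain t where t: "\<And>j. j \<le> n \<Longrightarrow> g (t j) = g 0 + 2*pi * j / n" by metis
  have incr: "g (t (Suc j)) - g (t j) = 2*pi / n" if "j < n" for j
    using that by (simp add: t add_divide_distrib distrib_left)
  have t_mono: "t j \<le> t (Suc j)" if "j < n" for j
  proof (rule mono)
    have "0 \<le> 2*pi / n" by simp
    then show "g (t j) \<le> g (t (Suc j))" using incr[OF that] by linarith
  qed
  have t_step: "t (Suc j) - t j \<le> 2*pi / (m * n)" if "j < n" for j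
  proof -
    have "m * (t (Suc j) - t j) \<le> 2*pi / n" using growth[OF t_mono[OF that]] incr[OF that] by linarith
    then show ?thesis using m(1) n0 by (simp add: field_simps)
  qed
  have t_period: "t n = t 0 + 2*pi"
  proof (rule antisym)
    have "g (t n) = g (t 0 + 2*pi)" using n0 by (simp add: t shift)
    then show "t n \<le> t 0 + 2*pi" "t 0 + 2*pi \<le> t n" by (auto intro: mono)
  qed
  show ?thesis
  proof (rule that[of r n t])
    fix x
    have "\<bar>(\<Sum>j<n. poisson r (x - t (Suc j)) * (g (t (Suc j)) - g (t j))) - 2*pi * u x\<bar>
         \<le> 2*pi * (\<delta>/3 + (K * ((1 - r\<^sup>2) / (2*r)) + 2 / (1 - r)^4 * (2*pi / (m * n)) * M))"
      using pos by (intro poisson_riemann_sum r(1,2) g M(2) K t_mono t_step t_period) (auto intro: less_imp_le)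
    also have "\<dots> \<le> 2*pi * \<delta>"
      using kernel_error step_error by (intro mult_left_mono) auto
    also have "(\<Sum>j<n. poisson r (x - t (Suc j)) * (g (t (Suc j)) - g (t j)))
        = (\<Sum>j<n. poisson r (x - t (Suc j))) * (2*pi / n)"
      unfolding sum_distrib_right by (intro sum.cong) (auto simp: incr)
    also have "(\<Sum>j<n. poisson r (x - t (Suc j))) = (\<Sum>j=1..n. poisson r (x - t j))"
      by (rule sum.reindex_bij_witness[of _ "\<lambda>j. j - 1" Suc]) auto
    finally have "\<bar>2*pi * ((\<Sum>j=1..n. poisson r (x - t j)) / n - u x)\<bar> \<le> 2*pi * \<delta>"
      by (simp add: algebra_simps)
    then show "\<bar>(\<Sum>j=1..n. poisson r (x - t j)) / n - u x\<bar> \<le> \<delta>"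
      by (simp add: abs_mult)
  qed (use r n0 in auto)
qed

section \<open>The angular lift of an orientation-preserving diffeomorphism\<close>

text \<open>
  The angular speed \<open>u\<close> can be read off from the derivative; any antiderivative of it is an argument
  of the map up to a constant. The degree, that is the total increase of the lift divided by \<open>2*pi\<close>,
  is an integer. It is positive because \<open>u > 0\<close>, and it is less than 2 because otherwise the lift would
  gain \<open>2*pi\<close> strictly inside a period, contrary to injectivity.
\<close>

lemma orientation_preserving_diffeo_lift:
  assumes diffeo: "circle_diffeo \<Psi>" and orient: "orientation_preserving \<Psi>"
  obtains g u :: "real \<Rightarrow> real" where "\<And>x. \<Psi> (cis x) = cis (g x)"
    "\<And>x. (g has_real_derivative u x) (at x)" "continuous_on UNIV u" "\<And>x. 0 < u x"
    "\<And>x. g (x + 2*pi) = g x + 2*pi"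
proof -
  define f where "f = on_circle \<Psi>"
  define D where "D = circle_deriv \<Psi>"
  have bij: "bij_betw \<Psi> unit_circle unit_circle" and smooth: "circle_smooth \<Psi>"
    using diffeo by (auto simp: circle_diffeo_def)
  have "f differentiable_on UNIV"
    using smooth[unfolded circle_smooth_def, rule_format, of 0] by (simp add: f_def)
  then have f: "(f has_vector_derivative D x) (at x)" for x
    unfolding D_def circle_deriv_def f_def
    by (simp add: differentiable_on_def vector_derivative_works)
  have "D differentiable_on UNIV"
    using smooth[unfolded circle_smooth_def, rule_format, of 1] by (simp add: D_def circle_deriv_def[abs_def])
  then have D_cont: "continuous_on UNIV D" by (rule differentiable_imp_continuous_on)
  have f_cont: "continuous_on UNIV f"
    using f by (meson continuous_at_imp_continuous_on has_vector_derivative_continuous)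
  have f_norm: "norm (f x) = 1" for x
    using bij_betwE[OF bij, rule_format, of "cis x"] by (simp add: f_def)
  define u where "u x = Re (D x * cnj (\<i> * f x))" for x
  have u_cont: "continuous_on UNIV u"
    unfolding u_def[abs_def] by (intro continuous_intros D_cont f_cont)
  have u: "0 < u x" "D x = of_real (u x) * (\<i> * f x)" for x
  proof -
    obtain c where c: "c > 0" "D x = of_real c * (\<i> * f x)"
      using orient unfolding orientation_preserving_def D_def f_def by blast
    have "(\<i> * f x) * cnj (\<i> * f x) = 1"
      unfolding complex_norm_square[symmetric] by (simp add: norm_mult f_norm)
    then have "u x = c" unfolding u_def c(2) mult.assoc by simp
    then show "0 < u x" "D x = of_real (u x) * (\<i> * f x)" using c by auto
  qed
  have "\<exists>G. \<forall>x::real. -\<infinity> < ereal x \<longrightarrow> ereal x < \<infinity> \<longrightarrow> (G has_vector_derivative u x) (at x)"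
    using u_cont by (intro einterval_antiderivative) (auto simp: continuous_on_eq_continuous_at)
  then obtain G where G: "\<And>x. (G has_real_derivative u x) (at x)"
    by (auto simp: has_real_derivative_iff_has_vector_derivative)
  \<comment> \<open>\<open>f\<close> and \<open>cis \<circ> G\<close> solve the same linear differential equation, so their quotient is constant.\<close>
  have "((\<lambda>x. f x * cis (- G x)) has_derivative (\<lambda>h. 0)) (at x within UNIV)" for x
  proof -
    have "((\<lambda>x. cis (- G x)) has_vector_derivative of_real (- u x) * (\<i> * cis (- G x))) (at x)"
      by (intro has_vector_derivative_cis_compose DERIV_minus G)
    from has_vector_derivative_mult[OF f this]
    have "((\<lambda>x. f x * cis (- G x)) has_vector_derivative 0) (at x)"
      by (simp add: u(2) algebra_simps)
    then show ?thesis by (simp add: has_vector_derivative_def)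
  qed
  then have const: "f x * cis (- G x) = f 0 * cis (- G 0)" for x
    using has_derivative_zero_unique[of UNIV "\<lambda>x. f x * cis (- G x)" x 0] by simp
  define \<phi> where "\<phi> = Arg (f 0 * cis (- G 0))"
  have phi: "f 0 * cis (- G 0) = cis \<phi>"
    unfolding \<phi>_def by (subst cis_Arg) (use f_norm[of 0] in \<open>auto simp: norm_mult sgn_div_norm\<close>)
  define g where "g x = \<phi> + G x" for x
  have fg: "f x = cis (g x)" for x
  proof -
    have "cis (g x) = f x * cis (- G x) * cis (G x)"
      using const[of x] phi by (simp add: g_def cis_mult)
    then show ?thesis by (simp add: mult.assoc cis_mult)
  qed
  have g: "(g has_real_derivative u x) (at x)" for x
    unfolding g_def[abs_def] by (auto intro!: derivative_eq_intros G)
  have g_strict: "g a < g b" if "a < b" for a b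
    using that by (rule DERIV_pos_imp_increasing) (use g u(1) in blast)
  have u_per: "u (x + 2*pi) = u x" for x
  proof -
    have f_per: "(\<lambda>x. f (x + 2*pi)) = f" by (auto simp: f_def simp flip: cis_mult)
    have "((\<lambda>x. x + 2*pi) has_vector_derivative 1) (at x)"
      by (auto intro!: derivative_eq_intros simp flip: has_real_derivative_iff_has_vector_derivative)
    from vector_diff_chain_at[OF this f]
    have "((\<lambda>x. f (x + 2*pi)) has_vector_derivative D (x + 2*pi)) (at x)"
      by (simp add: o_def)
    then have "D (x + 2*pi) = D x"
      unfolding f_per using f[of x] by (metis vector_derivative_at)
    then show ?thesis using f_per unfolding u_def by metis
  qed
  have shift: "g (x + 2*pi) = g x + 2*pi" for x
  proof -
    have "((\<lambda>x. g (x + 2*pi) - g x) has_real_derivative 0) (at x)" for x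
      using DERIV_diff[OF g[of "x + 2*pi", unfolded DERIV_shift] g[of x]] by (simp add: u_per)
    then have c: "g (x + 2*pi) - g x = g (0 + 2*pi) - g 0"
      by (intro DERIV_isconst_all) blast
    have "cis (g (2*pi)) = cis (g 0)"
      using fg[of 0] fg[of "2*pi"] by (simp add: f_def)
    then have "sin (g (2*pi)) = sin (g 0) \<and> cos (g (2*pi)) = cos (g 0)"
      by (simp add: complex_eq_iff)
    then obtain d :: int where d: "g (2*pi) = g 0 + 2*pi * of_int d"
      unfolding sin_cos_eq_iff by auto
    have "0 < 2*pi * of_int d" using g_strict[of 0 "2*pi"] d by simp
    then have "0 < d" by (simp add: zero_less_mult_iff)
    moreover have "\<not> 2 \<le> d"
    proof
      assume "2 \<le> d"
      then have "2*pi * 2 \<le> 2*pi * of_int d" by (intro mult_left_mono) auto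
      then have lt: "g 0 + 2*pi < g (2*pi)" using d pi_gt_zero by linarith
      have "continuous_on {0..2*pi} g" by (meson g DERIV_continuous_on has_field_derivative_at_within)
      then obtain y where y: "0 \<le> y" "y \<le> 2*pi" "g y = g 0 + 2*pi"
        using IVT'[of g 0 "g 0 + 2*pi" "2*pi"] lt by auto
      then have "\<Psi> (cis y) = \<Psi> (cis 0)" using fg[of y] fg[of 0] by (simp add: f_def flip: cis_mult)
      then have "cis y = cis 0" using bij by (auto simp: bij_betw_def dest: inj_onD)
      then have "sin y = sin 0 \<and> cos y = cos 0" by (simp add: complex_eq_iff)
      then obtain l :: int where l: "y = 2*pi * of_int l"
        unfolding sin_cos_eq_iff by auto
      moreover have "y \<noteq> 0" "y \<noteq> 2*pi" using y lt by auto
      ultimately have "0 < 2*pi * of_int l" "2*pi * of_int l < 2*pi * 1"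
        using y(1,2) by linarith+
      then have "0 < l" "l < 1"
        unfolding zero_less_mult_iff mult_less_cancel_left by auto
      then show False by simp
    qed
    ultimately have "d = 1" by linarith
    then show ?thesis using c d by simp
  qed
  show ?thesis using fg g u_cont u(1) shift by (intro that[of g u]) (auto simp: f_def)
qed

section \<open>Roots of Blaschke products\<close>

text \<open>
  Dividing the arguments \<open>- 2 * Im (Ln (1 - cnj (a j) * z))\<close> by \<open>n\<close>, and leaving the factor \<open>z\<close> whole
  because it occurs once in each of the \<open>n\<close> Blaschke factors, gives a root that is visibly a
  continuous function of \<open>z\<close> and not only of the angle.
\<close>

definition blaschke_root :: "nat \<Rightarrow> (nat \<Rightarrow> complex) \<Rightarrow> real \<Rightarrow> complex \<Rightarrow> complex" where
  "blaschke_root n a c z = cis c * z * cis ((\<Sum>j=1..n. - 2 * Im (Ln (1 - cnj (a j) * z))) / n)"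

lemma blaschke_root_cis:
  assumes "n \<ge> 1"
  shows "blaschke_root n a c (cis x) = cis (c + (\<Sum>j=1..n. blaschke_arg (a j) x) / n)"
proof -
  have "(\<Sum>j=1..n. blaschke_arg (a j) x) / n
      = x + (\<Sum>j=1..n. - 2 * Im (Ln (1 - cnj (a j) * cis x))) / n"
    using assms by (simp add: blaschke_arg_def sum.distrib sum_subtractf sum_negf add_divide_distrib diff_divide_distrib)
  then show ?thesis unfolding blaschke_root_def by (simp add: cis_mult add.assoc)
qed

lemma blaschke_root_power:
  assumes "n \<ge> 1" and a: "\<And>j. j \<in> {1..n} \<Longrightarrow> norm (a j) < 1" and z: "norm z = 1"
  shows "blaschke_root n a c z ^ n = blaschke (n * c) n a z"
proof -
  let ?s = "\<lambda>j. - 2 * Im (Ln (1 - cnj (a j) * z))"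
  have "blaschke_root n a c z ^ n = cis (n * c) * (z ^ n * cis (\<Sum>j=1..n. ?s j))"
    using \<open>n \<ge> 1\<close> unfolding blaschke_root_def by (simp add: power_mult_distrib Complex.DeMoivre)
  also have "z ^ n * cis (\<Sum>j=1..n. ?s j) = (\<Prod>j=1..n. z * cis (?s j))"
    unfolding cis_sum prod.distrib by simp
  also have "\<dots> = (\<Prod>j=1..n. (z - a j) / (1 - cnj (a j) * z))"
    using a z by (intro prod.cong refl blaschke_factor_polar) auto
  finally show ?thesis by (simp add: blaschke_def)
qed

lemma continuous_on_blaschke_root:
  assumes a: "\<And>j. j \<in> {1..n} \<Longrightarrow> norm (a j) < 1"
  shows "continuous_on unit_circle (blaschke_root n a c)"
proof -
  have "1 - cnj (a j) * z \<notin> \<real>\<^sub>\<le>\<^sub>0" if "j \<in> {1..n}" "z \<in> unit_circle" for j z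
    using Re_blaschke_denominator_pos[of "a j" z] a[OF that(1)] that(2)
    by (simp add: complex_nonpos_Reals_iff)
  then have "continuous_on unit_circle (\<lambda>z. (\<Sum>j=1..n. - 2 * Im (Ln (1 - cnj (a j) * z))) / n)"
    by (cases "n = 0") (simp_all, intro continuous_intros, auto)
  from continuous_on_cis[OF this] show ?thesis
    unfolding blaschke_root_def[abs_def] by (intro continuous_on_mult continuous_on_const continuous_on_id)
qed

text \<open>
  The derivatives differ by \<open>u * (cis g - cis h) + (u - v) * cis h\<close>, up to the factor \<open>\<i>\<close>.
\<close>

lemma circle_C1_distance_via_lifts:
  assumes f: "\<And>x. f (cis x) = cis (g x)" and g: "\<And>x. (g has_real_derivative u x) (at x)"
    and k: "\<And>x. k (cis x) = cis (h x)" and h: "\<And>x. (h has_real_derivative v x) (at x)"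
    and close: "\<And>x. \<bar>g x - h x\<bar> \<le> A" "\<And>x. \<bar>u x - v x\<bar> \<le> B" and u: "\<And>x. \<bar>u x\<bar> \<le> M"
  shows "circle_C1_norm (\<lambda>z. f z - k z) \<le> A + (M * A + B)"
  unfolding circle_C1_norm_def
proof (rule cSUP_least)
  fix x
  have 1: "norm (cis (g x) - cis (h x)) \<le> A"
    using norm_cis_diff_le close(1) by (rule order_trans)
  have "((\<lambda>x. f (cis x) - k (cis x)) has_vector_derivative
      of_real (u x) * (\<i> * cis (g x)) - of_real (v x) * (\<i> * cis (h x))) (at x)"
    unfolding f k by (intro has_vector_derivative_diff has_vector_derivative_cis_compose g h)
  then have "circle_deriv (\<lambda>z. f z - k z) x
      = of_real (u x) * (\<i> * cis (g x)) - of_real (v x) * (\<i> * cis (h x))"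
    unfolding circle_deriv_def by (rule vector_derivative_at)
  also have "\<dots> = of_real (u x) * (\<i> * (cis (g x) - cis (h x))) + of_real (u x - v x) * (\<i> * cis (h x))"
    by (simp add: algebra_simps)
  also have "norm \<dots> \<le> \<bar>u x\<bar> * norm (cis (g x) - cis (h x)) + \<bar>u x - v x\<bar>"
    by (rule norm_triangle_le) (simp add: norm_mult flip: of_real_diff)
  also have "\<dots> \<le> M * A + B"
    using 1 close(2) u by (intro add_mono mult_mono) (auto intro: order_trans[OF abs_ge_zero])
  finally show "norm (f (cis x) - k (cis x)) + norm (circle_deriv (\<lambda>z. f z - k z) x) \<le> A + (M * A + B)"
    using 1 unfolding f k by linarith
qed simp

section \<open>Density of the roots of Blaschke products\<close>

theorem theorem2p3:
  fixes \<Psi> :: "complex \<Rightarrow> complex" and \<epsilon> :: real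
  assumes "circle_diffeo \<Psi>" and "orientation_preserving \<Psi>" and "\<epsilon> > 0"
  shows "\<exists>(n::nat) (\<theta>::real) (a::nat \<Rightarrow> complex) (k::complex \<Rightarrow> complex).
           n \<ge> 1 \<and> (\<forall>j\<in>{1..n}. a j \<in> ball 0 1) \<and>
           k \<in> unit_circle \<rightarrow> unit_circle \<and> continuous_on unit_circle k \<and>
           (\<forall>z\<in>unit_circle. k z ^ n = blaschke \<theta> n a z) \<and>
           circle_C1 k \<and> circle_C1_norm (\<lambda>z. \<Psi> z - k z) < \<epsilon>"
proof -
  obtain g u where \<Psi>: "\<And>x. \<Psi> (cis x) = cis (g x)"
    and g: "\<And>x. (g has_real_derivative u x) (at x)" and u_cont: "continuous_on UNIV u"
    and u_pos: "\<And>x. 0 < u x" and g_shift: "\<And>x. g (x + 2*pi) = g x + 2*pi"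
    by (rule orientation_preserving_diffeo_lift[OF assms(1,2)]) metis
  have "u (x + 2*pi) = u x" for x
    by (rule derivative_of_degree_one_lift_periodic[of g, OF g g_shift])
  from periodic_positive_bounds[OF u_cont this u_pos]
  obtain M where M: "0 < M" "\<And>x. u x \<le> M" by metis
  \<comment> \<open>If \<open>h'\<close> is within \<open>\<delta>\<close> of \<open>u\<close>, then \<open>h\<close> is within \<open>2*pi * \<delta>\<close> of \<open>g\<close>, so the \<open>C\<^sup>1\<close> distance is at
    most \<open>L * \<delta>\<close>.\<close>
  define L where "L = 2*pi + (M * (2*pi) + 1)"
  have L: "L > 0" using M(1) by (simp add: L_def add_pos_pos)
  define \<delta> where "\<delta> = \<epsilon> / 2 / L"
  have \<delta>: "\<delta> > 0" using L \<open>\<epsilon> > 0\<close> by (simp add: \<delta>_def)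
  obtain r :: real and n :: nat and t :: "nat \<Rightarrow> real" where r: "0 < r" "r < 1" and n: "n \<ge> 1"
    and approx: "\<And>x. \<bar>(\<Sum>j=1..n. poisson r (x - t j)) / n - u x\<bar> \<le> \<delta>"
    by (rule poisson_means_dense[of g u \<delta>, OF g u_cont u_pos g_shift \<delta>]) (rule that)
  define a where "a j = of_real r * cis (t j)" for j
  have a: "norm (a j) < 1" for j using r by (simp add: a_def norm_mult)
  define h0 where "h0 x = (\<Sum>j=1..n. blaschke_arg (a j) x) / n" for x
  \<comment> \<open>This rotation makes the two lifts agree at \<open>0\<close>.\<close>
  define c where "c = g 0 - h0 0"
  define k where "k = blaschke_root n a c"
  define h where "h x = c + h0 x" for x
  define v where "v x = (\<Sum>j=1..n. poisson r (x - t j)) / n" for x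
  have k: "k (cis x) = cis (h x)" for x
    unfolding k_def blaschke_root_cis[OF n] h_def h0_def ..
  have h: "(h has_real_derivative v x) (at x)" for x
    unfolding h_def[abs_def] h0_def[abs_def] v_def a_def using n
    by (auto intro!: derivative_eq_intros blaschke_arg_deriv r)
  have h_shift: "h (x + 2*pi) = h x + 2*pi" for x
    using n by (simp add: h_def h0_def blaschke_arg_plus_2pi sum.distrib add_divide_distrib)
  have uv: "\<bar>u x - v x\<bar> \<le> \<delta>" for x using approx[of x] by (simp add: v_def abs_minus_commute)
  have gh: "\<bar>g x - h x\<bar> \<le> 2*pi * \<delta>" for x
  proof -
    obtain y where y: "y \<in> {0..2*pi}" "g x - h x = g y - h y"
      using periodic_value_in_fundamental_interval[of "\<lambda>x. g x - h x" x] by (auto simp: g_shift h_shift)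
    have "\<bar>(g y - h y) - (g 0 - h 0)\<bar> \<le> \<delta> * y - \<delta> * 0"
      using y(1) uv by (intro increment_bound_by_derivative[where H' = "\<lambda>x. u x - v x" and \<phi>' = "\<lambda>x. \<delta>"])
        (auto intro!: derivative_eq_intros g h)
    also have "\<dots> \<le> 2*pi * \<delta>" using y(1) \<delta> by (simp add: mult.commute)
    finally show ?thesis unfolding y(2) by (simp add: h_def c_def)
  qed
  have v_cont: "continuous_on UNIV v"
    unfolding v_def[abs_def] using n
    by (intro continuous_on_divide continuous_on_sum continuous_on_const continuous_on_poisson r) auto
  have "circle_C1_norm (\<lambda>z. \<Psi> z - k z) \<le> 2*pi * \<delta> + (M * (2*pi * \<delta>) + \<delta>)"
    using u_pos M by (intro circle_C1_distance_via_lifts[OF \<Psi> g k h gh uv]) (simp add: less_imp_le)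
  also have "\<dots> = L * \<delta>" by (simp add: L_def algebra_simps)
  also have "\<dots> < \<epsilon>" using L \<open>\<epsilon> > 0\<close> by (simp add: \<delta>_def)
  finally have norm_small: "circle_C1_norm (\<lambda>z. \<Psi> z - k z) < \<epsilon>" .
  have k_C1: "circle_C1 k"
    unfolding circle_C1_def C1_differentiable_on_def k
  proof (intro exI conjI ballI)
    show "((\<lambda>x. cis (h x)) has_vector_derivative of_real (v x) * (\<i> * cis (h x))) (at x)" for x
      by (rule has_vector_derivative_cis_compose[OF h])
    have "continuous_on UNIV h" using h by (rule DERIV_continuous_on)
    then show "continuous_on UNIV (\<lambda>x. of_real (v x) * (\<i> * cis (h x)))"
      by (intro continuous_on_mult continuous_on_of_real continuous_on_const continuous_on_cis v_cont)
  qed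
  show ?thesis
  proof (intro exI conjI ballI)
    show "k \<in> unit_circle \<rightarrow> unit_circle" by (auto simp: k_def blaschke_root_def norm_mult)
    show "k z ^ n = blaschke (n * c) n a z" if "z \<in> unit_circle" for z
      unfolding k_def using that a by (intro blaschke_root_power n) auto
    show "continuous_on unit_circle k" unfolding k_def by (rule continuous_on_blaschke_root) (rule a)
  qed (use n a k_C1 norm_small in auto)
qed

end
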